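(* $\vec{\chi}(\mathrm{Forb}_{\mathrm{ind}}(\overset{\leftrightarrow}{K}_2,S_2^+,\vec{C}_3))=\vec{\chi}(\mathrm{Forb}_{\mathrm{ind}}(\overset{\leftrightarrow}{K}_2,S_2^-,\vec{C}_3))=2.$
   Context: All digraphs are finite and simple: no loops, and between two vertices at most one arc in each direction (so pairs of opposite arcs are allowed in general). $(u,v)$ denotes an arc with tail $u$ and head $v$. For a vertex set $X$ of a digraph $D$, $D[X]$ is the induced subdigraph on $X$. An acyclic $k$-coloring of a digraph $D$ is a map $c:V(D)\to S$ with $|S|=k$ such that each color class $c^{-1}(i)$, $i \in S$, induces a subdigraph without directed cycles (a digon, i.e. a pair of opposite arcs $(x,y),(y,x)$, counts as a directed cycle of length two). The dichromatic number $\vec{\chi}(D)$ is the smallest $k$ for which an acyclic $k$-coloring of $D$ exists. For a set (or list) $\mathcal{F}$ of digraphs, $\mathrm{Forb}_{\mathrm{ind}}(\mathcal{F})$ is the set of digraphs containing no induced subdigraph isomorphic to a member of $\mathcal{F}$. When the digraphs in this class have bounded dichromatic number, $\vec{\chi}(\mathrm{Forb}_{\mathrm{ind}}(\mathcal{F})):=\max\{\vec{\chi}(D) \mid D\in \mathrm{Forb}_{\mathrm{ind}}(\mathcal{F})\}$; an equality for this quantity includes the assertion that it is well defined. $\overset{\leftrightarrow}{K}_2$ is the digon: two vertices joined by arcs in both directions. $S_2^+$ (resp. $S_2^-$) is the orientation of the star with $2$ leaves in which both arcs are directed away from (resp. towards) the center. $\vec{C}_3$ is the directed triangle. *)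

theory Defs
  imports
    "Graph_Theory.Digraph_Component"
    "Graph_Theory.Digraph_Isomorphism"
    "Graph_Theory.Pair_Digraph"
    "HOL-Library.FuncSet"
    "HOL-Library.Infinite_Typeclass"
begin

text \<open>
  A finite simple digraph (no loops, no parallel arcs, opposite arcs allowed) is a
  \<^typ>\<open>'a pair_pre_digraph\<close> satisfying the locale predicate \<^const>\<open>pair_digraph\<close>.
  It is written \<open>with_proj D\<close> where the library notions for general digraphs are applied to it.
\<close>

section \<open>Dichromatic number\<close>

text \<open>
  A digon yields a \<^const>\<open>pre_digraph.cycle\<close> of length two, so it is never monochromatic.
\<close>

definition acyclic_digraph :: "('a, 'b) pre_digraph \<Rightarrow> bool" where
  "acyclic_digraph G \<longleftrightarrow> (\<nexists>p. pre_digraph.cycle G p)"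

definition acyclic_coloring :: "'a pair_pre_digraph \<Rightarrow> 'c set \<Rightarrow> ('a \<Rightarrow> 'c) \<Rightarrow> bool" where
  "acyclic_coloring D S c \<longleftrightarrow>
     c \<in> pverts D \<rightarrow> S \<and>
     (\<forall>i\<in>S. acyclic_digraph (with_proj D \<restriction> {v \<in> pverts D. c v = i}))"

text \<open>
  Only the cardinality of the colour set matters, so colours are taken from \<^typ>\<open>nat\<close>;
  \<^term>\<open>finite S\<close> is needed because \<^const>\<open>card\<close> is 0 on infinite sets.
\<close>

definition acyclic_colorable :: "'a pair_pre_digraph \<Rightarrow> nat \<Rightarrow> bool" where
  "acyclic_colorable D k \<longleftrightarrow>
     (\<exists>(S :: nat set) c. finite S \<and> card S = k \<and> acyclic_coloring D S c)"

definition dichromatic_number :: "'a pair_pre_digraph \<Rightarrow> nat" where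
  "dichromatic_number D = (LEAST k. acyclic_colorable D k)"

text \<open>
  The maximum over a class of digraphs. It is meaningful only if the class is nonempty and the
  dichromatic numbers are bounded; boundedness has to be asserted separately.
\<close>

definition max_dichromatic_number :: "'a pair_pre_digraph set \<Rightarrow> nat" where
  "max_dichromatic_number \<C> = Max (dichromatic_number ` \<C>)"

section \<open>Forbidden induced subdigraphs\<close>

definition Forb_ind :: "'f pair_pre_digraph set \<Rightarrow> 'a pair_pre_digraph set" where
  "Forb_ind \<F> =
     {D. pair_digraph D \<and>
         \<not> (\<exists>F\<in>\<F>. \<exists>X\<subseteq>pverts D. digraph_iso (with_proj F) (with_proj D \<restriction> X))}"

definition digon :: "nat pair_pre_digraph" where
  "digon = \<lparr> pverts = {0, 1}, parcs = {(0, 1), (1, 0)} \<rparr>"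

text \<open>In both stars the centre is 0.\<close>

definition out_star_2 :: "nat pair_pre_digraph" where
  "out_star_2 = \<lparr> pverts = {0, 1, 2}, parcs = {(0, 1), (0, 2)} \<rparr>"

definition in_star_2 :: "nat pair_pre_digraph" where
  "in_star_2 = \<lparr> pverts = {0, 1, 2}, parcs = {(1, 0), (2, 0)} \<rparr>"

definition directed_triangle :: "nat pair_pre_digraph" where
  "directed_triangle = \<lparr> pverts = {0, 1, 2}, parcs = {(0, 1), (1, 2), (2, 0)} \<rparr>"

text \<open>
  Results about classes of digraphs are stated for vertices from an arbitrary infinite type
  (class \<^class>\<open>infinite\<close>): it contains a copy of every finite digraph, so no digraph is lost,
  whereas over a small finite type the maximum over a class could be smaller.
\<close>

end

theory Submission
  imports Defs
begin

text \<open>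
  Forbidding the digon, \<open>S\<^sub>2\<^sup>+\<close> and the directed triangle makes every out-neighbourhood a transitive
  tournament. For oriented graphs with that property, the following is proved by induction on the
  number of vertices: for every vertex \<open>v\<close> there is an acyclic 2-colouring in which the closed
  out-neighbourhood of \<open>v\<close> is monochromatic (lemma \<open>bicoloring_exists\<close>). The monochromatic
  neighbourhood is what makes the induction work: it allows the colours to be controlled at all
  vertices through which a cycle can enter a smaller piece of the digraph.

  If the digraph is not strong, some proper nonempty set \<open>B\<close> has no arc leaving it, and colourings of
  \<open>B\<close> and its complement fit together. The out-neighbours of \<open>v\<close> in \<open>B\<close> form a transitive
  tournament, so they lie in the closed out-neighbourhood of its source, at which the colouring of
  \<open>B\<close> is rooted.

  If it is strong, call a proper nonempty strong vertex set an out-module if all its vertices have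
  the same out-neighbours outside. Two out-modules are nested or disjoint (a crossing pair would
  produce a digon), so the maximal ones, the blocks, partition the vertices. Map a block \<open>X\<close> to the
  block containing the source of the transitive tournament of out-neighbours of \<open>X\<close>. The blocks on a
  cycle of this map have a union that is strong and whose vertices again share their outside
  out-neighbours; by maximality the union is everything (\<open>cycle_of_blocks_covers\<close>). Hence the blocks
  are cyclically arranged, \<open>X\<^sub>0, X\<^sub>1, \<dots>\<close> with \<open>v \<in> X\<^sub>0\<close>, and an arc entering \<open>X\<^sub>j\<close> from
  any block makes its head an out-neighbour of all blocks that come cyclically between. For
  \<open>j > 0\<close> it follows that all vertices at which \<open>X\<^sub>j\<close> is entered lie in one closed out-neighbourhood
  inside \<open>X\<^sub>j\<close>, so by induction \<open>X\<^sub>j\<close> has a colouring in which they share a colour, and that colour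
  can be chosen: red when \<open>X\<^sub>0\<close> has an out-neighbour in \<open>X\<^sub>j\<close>, and blue otherwise. On \<open>X\<^sub>0\<close> the
  colouring is rooted at \<open>v\<close>, and \<open>X\<^sub>0\<close> counts as red.

  No monochromatic cycle visits several blocks (\<open>glue_block_colorings\<close>). All arcs leaving \<open>X\<^sub>0\<close> end
  in red vertices, so a blue cycle would avoid \<open>X\<^sub>0\<close> and use an arc to a block with smaller index.
  Such an arc jumps over \<open>X\<^sub>0\<close>, so its head is an out-neighbour of \<open>X\<^sub>0\<close> and red. A red cycle would
  visit only red blocks and would use an arc from a red block to one with smaller index, which
  yields a digon.

  The class that forbids \<open>S\<^sub>2\<^sup>-\<close> follows by reversing all arcs, which preserves cycles. The directed
  4-cycle lies in both classes and needs two colours.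
\<close>

section \<open>Acyclic two-colourings of a relation\<close>

text \<open>
  Along a path the rank of the block never decreases, and it strictly increases when the path changes
  block; so a closed walk stays in one block.
\<close>

lemma acyclic_if_blocks_acyclic:
  fixes r :: "'b \<Rightarrow> nat"
  assumes cross: "\<And>x y. (x, y) \<in> R \<Longrightarrow> p x \<noteq> p y \<Longrightarrow> r (p x) < r (p y)"
    and blocks: "\<And>i. acyclic (Restr R {x. p x = i})"
  shows "acyclic R"
proof -
  have "r (p x) < r (p y) \<or> p x = p y \<and> (x, y) \<in> (Restr R {z. p z = p x})\<^sup>+"
    if "(x, y) \<in> R\<^sup>+" for x y
    using that
  proof (induction rule: trancl_induct)
    case (base y)
    then show ?case using cross by (cases "p x = p y") auto
  next
    case (step y z)
    show ?case
    proof (cases "p y = p z")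
      case True
      with step show ?thesis by (auto intro: trancl_into_trancl)
    next
      case False
      with cross step.hyps have "r (p y) < r (p z)" by blast
      with step.IH show ?thesis by auto
    qed
  qed
  with blocks show ?thesis unfolding acyclic_def by blast
qed

text \<open>The colours are the truth values; \<^term>\<open>True\<close> is called red and \<^term>\<open>False\<close> blue.\<close>

definition acyclic_bicoloring :: "'a rel \<Rightarrow> 'a set \<Rightarrow> ('a \<Rightarrow> bool) \<Rightarrow> bool" where
  "acyclic_bicoloring E V c \<longleftrightarrow> (\<forall>b. acyclic (Restr E {x \<in> V. c x = b}))"

lemma acyclic_bicoloring_flip_cong:
  assumes "acyclic_bicoloring E V g" and "\<And>x. x \<in> V \<Longrightarrow> c x = (g x = b)"
  shows "acyclic_bicoloring E V c"
  unfolding acyclic_bicoloring_def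
proof
  fix b'
  have "{x \<in> V. c x = b'} = {x \<in> V. g x = (b = b')}"
    using assms(2) by auto
  then show "acyclic (Restr E {x \<in> V. c x = b'})"
    using assms(1) by (simp add: acyclic_bicoloring_def)
qed

text \<open>
  The rank may depend on the colour: red and blue cycles are excluded by different orders of the
  blocks.
\<close>

lemma acyclic_bicoloring_by_blocks:
  fixes r :: "bool \<Rightarrow> 'b \<Rightarrow> nat"
  assumes blocks: "\<And>i. acyclic_bicoloring E {x \<in> V. p x = i} c"
    and cross: "\<And>x y. \<lbrakk>x \<in> V; y \<in> V; (x, y) \<in> E; c x = c y; p x \<noteq> p y\<rbrakk>
                  \<Longrightarrow> r (c x) (p x) < r (c x) (p y)"
  shows "acyclic_bicoloring E V c"
  unfolding acyclic_bicoloring_def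
proof
  fix b
  show "acyclic (Restr E {x \<in> V. c x = b})"
  proof (rule acyclic_if_blocks_acyclic[where p = p and r = "r b"])
    show "r b (p x) < r b (p y)"
      if "(x, y) \<in> Restr E {x \<in> V. c x = b}" "p x \<noteq> p y" for x y
      using that cross[of x y] by auto
    show "acyclic (Restr (Restr E {x \<in> V. c x = b}) {x. p x = i})" for i
    proof -
      have "Restr (Restr E {x \<in> V. c x = b}) {x. p x = i}
            = Restr E {x \<in> {x \<in> V. p x = i}. c x = b}" by auto
      then show ?thesis using blocks[of i] by (simp add: acyclic_bicoloring_def)
    qed
  qed
qed

section \<open>Strong sets and out-modules\<close>

text \<open>
  Strong connectivity of the induced subdigraph, phrased by cuts instead of paths. A failure then
  directly supplies a set without outgoing arcs, and the property passes to unions of blocks.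
\<close>

definition strong :: "'a rel \<Rightarrow> 'a set \<Rightarrow> bool" where
  "strong E X \<longleftrightarrow> (\<forall>Y. Y \<noteq> {} \<longrightarrow> Y \<subset> X \<longrightarrow> (\<exists>y\<in>Y. \<exists>z\<in>X - Y. (y, z) \<in> E))"

lemma strongD:
  assumes "strong E X" "Y \<inter> X \<noteq> {}" "\<And>y z. y \<in> Y \<inter> X \<Longrightarrow> z \<in> X \<Longrightarrow> (y, z) \<in> E \<Longrightarrow> z \<in> Y"
  shows "X \<subseteq> Y"
proof (rule ccontr)
  assume "\<not> X \<subseteq> Y"
  then have "Y \<inter> X \<subset> X" by auto
  with assms(1,2) obtain y z where "y \<in> Y \<inter> X" "z \<in> X - Y \<inter> X" "(y, z) \<in> E"
    unfolding strong_def by meson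
  with assms(3) show False by blast
qed

definition out_module :: "'a rel \<Rightarrow> 'a set \<Rightarrow> 'a set \<Rightarrow> bool" where
  "out_module E V X \<longleftrightarrow> X \<noteq> {} \<and> X \<subset> V \<and> strong E X \<and>
     (\<forall>x\<in>X. \<forall>x'\<in>X. \<forall>y\<in>V - X. (x, y) \<in> E \<longrightarrow> (x', y) \<in> E)"

lemma out_moduleD:
  assumes "out_module E V X" "x \<in> X" "x' \<in> X" "y \<in> V" "y \<notin> X" "(x, y) \<in> E"
  shows "(x', y) \<in> E"
  using assms unfolding out_module_def by blast

text \<open>
  The arcs \<^term>\<open>E\<close> are fixed while the vertex set varies: all three properties are inherited by
  induced subdigraphs. A tournament is transitive iff it contains no directed triangle.
\<close>

locale transitive_out_neighborhoods =
  fixes E :: "'a rel"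
  assumes no_digon: "(x, y) \<in> E \<Longrightarrow> (y, x) \<notin> E"
    and out_adjacent: "\<lbrakk>(x, y) \<in> E; (x, z) \<in> E; y \<noteq> z\<rbrakk> \<Longrightarrow> (y, z) \<in> E \<or> (z, y) \<in> E"
    and no_dominated_triangle:
      "\<lbrakk>(x, a) \<in> E; (x, b) \<in> E; (x, d) \<in> E; (a, b) \<in> E; (b, d) \<in> E\<rbrakk> \<Longrightarrow> (d, a) \<notin> E"
begin

text \<open>
  A vertex with the most out-neighbours inside \<^term>\<open>A\<close> is a source: an in-neighbour \<open>w\<close> in
  \<^term>\<open>A\<close> would, for want of directed triangles, dominate all its out-neighbours and itself.
\<close>

lemma out_source_exists:
  assumes "finite A" "A \<noteq> {}" "A \<subseteq> E `` {x}"
  shows "\<exists>u\<in>A. \<forall>y\<in>A. y = u \<or> (u, y) \<in> E"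
proof -
  let ?d = "\<lambda>u. card (E `` {u} \<inter> A)"
  have "finite (?d ` A)" "?d ` A \<noteq> {}" using assms by auto
  then have "Max (?d ` A) \<in> ?d ` A" and ge: "\<And>w. w \<in> A \<Longrightarrow> ?d w \<le> Max (?d ` A)"
    by (auto intro: Max_in)
  then obtain u where u: "u \<in> A" and "Max (?d ` A) = ?d u" by blast
  with ge have max: "\<And>w. w \<in> A \<Longrightarrow> ?d w \<le> ?d u" by simp
  have "(w, u) \<notin> E" if w: "w \<in> A" for w
  proof
    assume wu: "(w, u) \<in> E"
    have "(w, z) \<in> E" if "z \<in> A" "(u, z) \<in> E" for z
    proof -
      have "z \<noteq> w" using that wu no_digon by blast
      moreover have "(z, w) \<notin> E"
        using no_dominated_triangle[of x w u z] w u that wu assms(3) by blast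
      ultimately show ?thesis using out_adjacent[of x z w] that w assms(3) by blast
    qed
    then have "insert u (E `` {u} \<inter> A) \<subseteq> E `` {w} \<inter> A" using wu u by auto
    moreover have "u \<notin> E `` {u} \<inter> A" using no_digon by blast
    ultimately have "?d u < ?d w"
      using assms(1) by (metis finite_Int insert_subset psubsetI psubset_card_mono)
    with max[OF w] show False by simp
  qed
  then have "y = u \<or> (u, y) \<in> E" if "y \<in> A" for y
    using out_adjacent[of x y u] that u assms(3) by blast
  with u show ?thesis by blast
qed

text \<open>
  If two out-modules cross, each is left by an arc from the intersection, since both are strong. Its
  head is then an out-neighbour of all vertices of the other out-module, and the two heads dominate
  each other.
\<close>

lemma out_modules_laminar:
  assumes X: "out_module E V X" and X': "out_module E V X'" and meet: "X \<inter> X' \<noteq> {}"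
  shows "X \<subseteq> X' \<or> X' \<subseteq> X"
proof (rule ccontr)
  assume neg: "\<not> (X \<subseteq> X' \<or> X' \<subseteq> X)"
  have "strong E X" "strong E X'" using X X' by (auto simp: out_module_def)
  then obtain x y x' z where xy: "x \<in> X \<inter> X'" "y \<in> X - X'" "(x, y) \<in> E"
      and xz: "x' \<in> X \<inter> X'" "z \<in> X' - X" "(x', z) \<in> E"
    using strongD[of E X X'] strongD[of E X' X] meet neg by blast
  have "X \<subseteq> V" "X' \<subseteq> V" using X X' by (auto simp: out_module_def)
  then have "(z, y) \<in> E" "(y, z) \<in> E"
    using out_moduleD[OF X' _ _ _ _ xy(3), of z] out_moduleD[OF X _ _ _ _ xz(3), of y] xy xz
    by blast+
  with no_digon show False by blast
qed

end

section \<open>Maximal out-modules of a strong digraph\<close>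

locale strong_transitive_out_neighborhoods = transitive_out_neighborhoods +
  fixes V :: "'a set"
  assumes finite_V: "finite V" and strong_V: "strong E V" and nontrivial: "\<And>x. V \<noteq> {x}"
begin

text \<open>The unique maximal out-module containing a given vertex.\<close>

definition block :: "'a \<Rightarrow> 'a set" where
  "block x = (SOME X. out_module E V X \<and> x \<in> X \<and>
                (\<forall>X'. out_module E V X' \<and> X \<subseteq> X' \<longrightarrow> X' = X))"

lemma block_maximal:
  assumes "x \<in> V"
  shows "out_module E V (block x)" and "x \<in> block x"
    and "\<And>X'. out_module E V X' \<Longrightarrow> block x \<subseteq> X' \<Longrightarrow> X' = block x"
proof -
  let ?F = "{X. out_module E V X \<and> x \<in> X}"
  have fin: "finite ?F" by (rule finite_subset[of _ "Pow V"]) (use finite_V in \<open>auto simp: out_module_def\<close>)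
  have "{x} \<in> ?F" using assms nontrivial[of x] by (auto simp: out_module_def strong_def)
  then obtain X where "X \<in> ?F" "\<And>X'. X' \<in> ?F \<Longrightarrow> X \<subseteq> X' \<Longrightarrow> X = X'"
    using finite_has_maximal[OF fin] by blast
  then have "\<exists>X. out_module E V X \<and> x \<in> X \<and> (\<forall>X'. out_module E V X' \<and> X \<subseteq> X' \<longrightarrow> X' = X)"
    by blast
  from someI_ex[OF this]
  have "out_module E V (block x) \<and> x \<in> block x \<and>
        (\<forall>X'. out_module E V X' \<and> block x \<subseteq> X' \<longrightarrow> X' = block x)"
    unfolding block_def .
  then show "out_module E V (block x)" "x \<in> block x"
      "\<And>X'. out_module E V X' \<Longrightarrow> block x \<subseteq> X' \<Longrightarrow> X' = block x" by blast+
qed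

lemma block_subset: "x \<in> V \<Longrightarrow> block x \<subset> V"
  using block_maximal(1) by (auto simp: out_module_def)

lemma block_eqI:
  assumes "x \<in> V" "y \<in> block x"
  shows "block y = block x"
proof -
  have y: "y \<in> V" using assms block_subset by blast
  have "block x \<subseteq> block y \<or> block y \<subseteq> block x"
    using out_modules_laminar[OF block_maximal(1)[OF assms(1)] block_maximal(1)[OF y]]
      block_maximal(2)[OF y] assms(2) by blast
  then show ?thesis
    using block_maximal(1,3)[OF assms(1)] block_maximal(1,3)[OF y] by metis
qed

lemma in_block_iff: "x \<in> V \<Longrightarrow> y \<in> V \<Longrightarrow> y \<in> block x \<longleftrightarrow> block y = block x"
  using block_eqI block_maximal(2) by metis

lemma block_out:
  assumes "x \<in> V" "y \<in> V" "(x, y) \<in> E" "block x \<noteq> block y" "z \<in> V" "block z = block x"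
  shows "(z, y) \<in> E"
  using out_moduleD[OF block_maximal(1)[OF assms(1)], of x z y] assms in_block_iff by metis

text \<open>
  The source of the tournament of outside out-neighbours of the block of \<^term>\<open>x\<close>. It is chosen in
  terms of the block alone, so that vertices of one block have the same successor.
\<close>

definition next_vertex :: "'a \<Rightarrow> 'a" where
  "next_vertex x = (SOME u. u \<in> V - block x \<and> (\<forall>z\<in>block x. (z, u) \<in> E) \<and>
     (\<forall>z\<in>block x. \<forall>y\<in>V - block x. (z, y) \<in> E \<longrightarrow> y = u \<or> (u, y) \<in> E))"

lemma next_vertex_source:
  assumes "x \<in> V"
  shows "next_vertex x \<in> V" and "block (next_vertex x) \<noteq> block x" and "(x, next_vertex x) \<in> E"
    and "\<And>y. \<lbrakk>y \<in> V; block y \<noteq> block x; (x, y) \<in> E\<rbrakk> \<Longrightarrow> y = next_vertex x \<or> (next_vertex x, y) \<in> E"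
proof -
  let ?A = "(V - block x) \<inter> E `` {x}"
  note M = block_maximal(1)[OF assms] block_maximal(2)[OF assms]
  obtain y z where "y \<in> block x" "z \<in> V - block x" "(y, z) \<in> E"
    using strongD[OF strong_V, of "block x"] block_subset[OF assms] M by blast
  then have "z \<in> ?A" using out_moduleD[OF M(1), of y x z] M by blast
  then obtain u where u: "u \<in> ?A" "\<forall>y\<in>?A. y = u \<or> (u, y) \<in> E"
    using out_source_exists[of ?A x] finite_V by blast
  have "\<exists>u. u \<in> V - block x \<and> (\<forall>z\<in>block x. (z, u) \<in> E) \<and>
     (\<forall>z\<in>block x. \<forall>y\<in>V - block x. (z, y) \<in> E \<longrightarrow> y = u \<or> (u, y) \<in> E)"
    using u out_moduleD[OF M(1)] M(2) by (intro exI[of _ u]) blast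
  from someI_ex[OF this]
  have *: "next_vertex x \<in> V - block x \<and> (\<forall>z\<in>block x. (z, next_vertex x) \<in> E) \<and>
     (\<forall>z\<in>block x. \<forall>y\<in>V - block x. (z, y) \<in> E \<longrightarrow> y = next_vertex x \<or> (next_vertex x, y) \<in> E)"
    unfolding next_vertex_def .
  then show "next_vertex x \<in> V" "(x, next_vertex x) \<in> E" using M by blast+
  show "block (next_vertex x) \<noteq> block x" using * in_block_iff[OF assms] by blast
  show "\<And>y. \<lbrakk>y \<in> V; block y \<noteq> block x; (x, y) \<in> E\<rbrakk> \<Longrightarrow> y = next_vertex x \<or> (next_vertex x, y) \<in> E"
    using * in_block_iff[OF assms] M by blast
qed

lemma next_vertex_cong: "block x = block y \<Longrightarrow> next_vertex x = next_vertex y"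
  by (simp add: next_vertex_def)

text \<open>
  The step that arranges blocks cyclically: an out-neighbour of a block is also an out-neighbour of
  the next block, unless it lies in there.
\<close>

lemma dominates_propagates:
  assumes "x \<in> V" "y \<in> V" "(x, y) \<in> E" "block y \<noteq> block x" "block y \<noteq> block (next_vertex x)"
  shows "(next_vertex x, y) \<in> E"
  using next_vertex_source(4)[OF assms(1,2,4,3)] assms(5) by blast

end

locale rooted_strong = strong_transitive_out_neighborhoods +
  fixes v :: 'a
  assumes v_in: "v \<in> V"
begin

definition orbit :: "nat \<Rightarrow> 'a" where
  "orbit i = (next_vertex ^^ i) v"

lemma orbit_0 [simp]: "orbit 0 = v"
  and orbit_Suc: "orbit (Suc i) = next_vertex (orbit i)"
  by (simp_all add: orbit_def)

lemma orbit_in [simp]: "orbit i \<in> V"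
  by (induction i) (auto simp: orbit_Suc v_in next_vertex_source(1))

lemma orbit_dominates_later:
  assumes "(orbit i, y) \<in> E" "y \<in> V" "i \<le> m" "\<And>l. i \<le> l \<Longrightarrow> l \<le> m \<Longrightarrow> block y \<noteq> block (orbit l)"
  shows "(orbit m, y) \<in> E"
  using assms(3,4)
proof (induction rule: dec_induct)
  case base
  then show ?case using assms(1) by simp
next
  case (step n)
  then show ?case
    using dominates_propagates[of "orbit n" y] assms(2) step.prems[of n] step.prems[of "Suc n"]
    by (simp add: orbit_Suc)
qed

text \<open>
  Otherwise the union would be an out-module larger than its blocks. It is strong because each block
  is and has an arc to the next one; and a vertex outside that is dominated by one block of the cycle
  is dominated by the next one, hence by all of them.
\<close>

lemma cycle_of_blocks_covers:
  assumes pq: "p < q" and eq: "block (orbit p) = block (orbit q)"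
  shows "(\<Union>i\<in>{p..<q}. block (orbit i)) = V" (is "?U = V")
proof (rule ccontr)
  assume "?U \<noteq> V"
  then have sub: "?U \<subset> V" using block_subset[OF orbit_in] by blast
  have UI: "block (orbit i) \<subseteq> ?U" if "p \<le> i" "i \<le> q" for i
  proof (cases "i = q")
    case True
    then show ?thesis using pq eq by (metis UN_upper atLeastLessThan_iff le_refl)
  next
    case False
    then show ?thesis using that by (intro UN_upper) auto
  qed
  \<comment> \<open>Induction along the cycle: from \<open>i\<close> up to \<open>q\<close>, over to \<open>p\<close>, and up to \<open>j\<close>.\<close>
  have around: "P j" if "p \<le> i" "i < q" "P i" "p \<le> j" "j \<le> q" "P q \<Longrightarrow> P p"
      "\<And>l. p \<le> l \<Longrightarrow> l < q \<Longrightarrow> P l \<Longrightarrow> P (Suc l)" for P i j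
  proof -
    have up: "P m" if "p \<le> l" "P l" "l \<le> m" "m \<le> q" for l m
      using that(3,4,1,2) \<open>\<And>l. p \<le> l \<Longrightarrow> l < q \<Longrightarrow> P l \<Longrightarrow> P (Suc l)\<close>
      by (induction rule: dec_induct) auto
    have "P p" using up[of i q] that by simp
    then show ?thesis using up[of p j] that by simp
  qed
  have module_U: "(x', y) \<in> E" if x: "x \<in> ?U" "x' \<in> ?U" and y: "y \<in> V - ?U" "(x, y) \<in> E" for x x' y
  proof -
    have ny: "block y \<noteq> block (orbit l)" if "p \<le> l" "l \<le> q" for l
      using y that UI[of l] in_block_iff[of "orbit l" y] by auto
    obtain i j where ij: "p \<le> i" "i < q" "x \<in> block (orbit i)" "p \<le> j" "j < q" "x' \<in> block (orbit j)"
      using x by auto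
    have xV: "x \<in> V" "x' \<in> V" using x sub by auto
    have bx: "block x = block (orbit i)" "block x' = block (orbit j)"
      using block_eqI[OF orbit_in ij(3)] block_eqI[OF orbit_in ij(6)] by auto
    have yV: "y \<in> V" using y by blast
    have "block x \<noteq> block y" using ny[of i] ij(1,2) bx(1) by (metis less_imp_le)
    then have "(orbit i, y) \<in> E"
      using block_out[OF xV(1) yV y(2) _ orbit_in] bx(1) by metis
    then have "(orbit j, y) \<in> E"
    proof (rule around[rotated 2, where P = "\<lambda>l. (orbit l, y) \<in> E"])
      show "(orbit p, y) \<in> E" if "(orbit q, y) \<in> E"
        using block_out[OF orbit_in yV that _ orbit_in eq] ny[of q] pq by force
      show "(orbit (Suc l), y) \<in> E" if "p \<le> l" "l < q" "(orbit l, y) \<in> E" for l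
        using dominates_propagates[OF orbit_in yV that(3)] that(1,2) ny[of l] ny[of "Suc l"]
        by (simp add: orbit_Suc)
    qed (use ij in simp_all)
    moreover have "block (orbit j) \<noteq> block y" using ny[of j] ij(4,5) by (metis less_imp_le)
    ultimately show ?thesis
      using block_out[OF orbit_in yV _ _ xV(2) bx(2)] by blast
  qed
  have strong_U: "strong E ?U"
    unfolding strong_def
  proof (intro allI impI, rule ccontr)
    fix Y assume Y: "Y \<noteq> {}" "Y \<subset> ?U" and "\<not> (\<exists>y\<in>Y. \<exists>z\<in>?U - Y. (y, z) \<in> E)"
    then have closed: "z \<in> Y" if "y \<in> Y" "z \<in> ?U" "(y, z) \<in> E" for y z
      using that by blast
    have whole: "block (orbit l) \<subseteq> Y" if l: "Y \<inter> block (orbit l) \<noteq> {}" "p \<le> l" "l \<le> q" for l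
    proof (rule strongD[OF _ l(1)])
      show "strong E (block (orbit l))"
        using block_maximal(1)[OF orbit_in] by (simp add: out_module_def)
      show "z \<in> Y" if "y \<in> Y \<inter> block (orbit l)" "z \<in> block (orbit l)" "(y, z) \<in> E" for y z
        using closed[OF _ _ that(3)] that(1,2) UI[OF l(2,3)] by blast
    qed
    obtain i where i: "p \<le> i" "i < q" "Y \<inter> block (orbit i) \<noteq> {}"
    proof -
      obtain y where "y \<in> Y" "y \<in> ?U" using Y by blast
      then show ?thesis using that by fastforce
    qed
    have "block (orbit j) \<subseteq> Y" if "p \<le> j" "j \<le> q" for j
    proof (rule around[of i "\<lambda>l. block (orbit l) \<subseteq> Y" j])
      show "block (orbit (Suc l)) \<subseteq> Y" if l: "p \<le> l" "l < q" "block (orbit l) \<subseteq> Y" for l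
      proof -
        have "orbit l \<in> Y" "orbit (Suc l) \<in> ?U"
          using l block_maximal(2)[OF orbit_in[of l]] block_maximal(2)[OF orbit_in[of "Suc l"]]
            UI[of "Suc l"] by (blast, fastforce)
        then have "orbit (Suc l) \<in> Y"
          using closed next_vertex_source(3)[OF orbit_in, of l] by (simp add: orbit_Suc)
        then show ?thesis
          using whole[of "Suc l"] block_maximal(2)[OF orbit_in, of "Suc l"] l by auto
      qed
      show "block (orbit i) \<subseteq> Y" using whole[OF i(3)] i(1,2) by simp
      show "block (orbit p) \<subseteq> Y" if "block (orbit q) \<subseteq> Y" using that eq by simp
    qed (use i that in simp_all)
    then have "?U \<subseteq> Y" by (intro UN_least) simp
    with Y show False by blast
  qed
  have nonempty_U: "?U \<noteq> {}" using UI[of p] pq block_maximal(2)[OF orbit_in[of p]] by fastforce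
  have "out_module E V ?U"
    unfolding out_module_def
    by (intro conjI ballI impI nonempty_U sub strong_U) (rule module_U)
  then have "?U = block (orbit p)"
    using block_maximal(3)[OF orbit_in, of ?U p] UI[of p] pq by simp
  moreover have "orbit (Suc p) \<in> ?U"
    using UI[of "Suc p"] pq block_maximal(2)[OF orbit_in, of "Suc p"] by fastforce
  ultimately show False
    using next_vertex_source(1,2)[OF orbit_in, of p] in_block_iff[of "orbit p" "orbit (Suc p)"]
    by (simp add: orbit_Suc)
qed

text \<open>
  The block of \<^term>\<open>v\<close> lies on the cycle and not on a tail leading to it, because the cycle contains
  all blocks.
\<close>

lemma orbit_block_returns: "\<exists>k>0. block (orbit k) = block v"
proof -
  have "\<not> inj orbit"
    using finite_V finite_imageD[of orbit UNIV] finite_subset[of "range orbit" V] orbit_in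
    by (metis image_subsetI infinite_UNIV_nat)
  then obtain p q where pq: "p < q" "orbit p = orbit q"
    unfolding inj_def by (metis linorder_neqE_nat)
  then have "v \<in> (\<Union>i\<in>{p..<q}. block (orbit i))" using cycle_of_blocks_covers v_in by simp
  then obtain i where i: "p \<le> i" "i < q" "block (orbit i) = block v"
    using in_block_iff v_in by auto
  show ?thesis
  proof (cases "i = 0")
    case True
    then show ?thesis using pq i by (metis le_zero_eq orbit_0)
  qed (use i in auto)
qed

definition period :: nat where
  "period = (LEAST k. k > 0 \<and> block (orbit k) = block v)"

lemma period: "period > 0" "block (orbit period) = block v"
  using LeastI_ex[OF orbit_block_returns] unfolding period_def by auto

text \<open>A repetition would make the orbit return to the block of \<^term>\<open>v\<close> earlier.\<close>

lemma orbit_blocks_distinct: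
  assumes "i < j" "j < period"
  shows "block (orbit i) \<noteq> block (orbit j)"
proof
  assume eq: "block (orbit i) = block (orbit j)"
  have "block (orbit (i + n)) = block (orbit (j + n))" for n
    by (induction n) (use eq in \<open>auto simp: orbit_Suc dest: next_vertex_cong\<close>)
  from this[of "period - j"] have "block (orbit (i + (period - j))) = block v"
    using assms period by simp
  moreover have "0 < i + (period - j)" "i + (period - j) < period" using assms by auto
  ultimately show False using not_less_Least[of "i + (period - j)"] unfolding period_def by blast
qed

definition index :: "'a \<Rightarrow> nat" where
  "index x = (THE i. i < period \<and> block x = block (orbit i))"

lemma index_unique:
  assumes "x \<in> V"
  shows "\<exists>!i. i < period \<and> block x = block (orbit i)"
proof -
  have "x \<in> (\<Union>i\<in>{0..<period}. block (orbit i))"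
    using cycle_of_blocks_covers[of 0 period] period assms by simp
  then obtain i where "i < period" "block x = block (orbit i)"
    using block_eqI[OF orbit_in] by auto
  then show ?thesis using orbit_blocks_distinct by (metis linorder_neqE_nat)
qed

lemma index:
  assumes "x \<in> V"
  shows "index x < period" "block x = block (orbit (index x))"
  using theI'[OF index_unique[OF assms]] unfolding index_def by auto

lemma index_eqI: "x \<in> V \<Longrightarrow> i < period \<Longrightarrow> block x = block (orbit i) \<Longrightarrow> index x = i"
  using the1_equality[OF index_unique] unfolding index_def by blast

lemma index_orbit [simp]: "i < period \<Longrightarrow> index (orbit i) = i"
  by (rule index_eqI) auto

lemma index_eq_iff: "x \<in> V \<Longrightarrow> y \<in> V \<Longrightarrow> index x = index y \<longleftrightarrow> block x = block y"
  using index(2)[of x] index(2)[of y] index_eqI[OF _ index(1), of x y] by metis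

lemma index_orbit_index [simp]: "x \<in> V \<Longrightarrow> index (orbit (index x)) = index x"
  using index(1) by simp

lemma index_v [simp]: "index v = 0"
  using index_orbit[of 0] period(1) by simp

lemma index_out:
  assumes "x \<in> V" "y \<in> V" "(x, y) \<in> E" "index x \<noteq> index y" "z \<in> V" "index z = index x"
  shows "(z, y) \<in> E"
  by (rule block_out[of x]) (use assms index_eq_iff in auto)

text \<open>
  In the cyclic order of blocks, the set of blocks dominating a vertex \<^term>\<open>y\<close> is closed under passing
  to the next block until the block of \<^term>\<open>y\<close> is reached. Cut open before the block of \<^term>\<open>v\<close>, this
  gives two cases; an arc to an earlier block, other than that of \<^term>\<open>v\<close>, shows that all blocks
  before that of \<^term>\<open>y\<close> dominate \<^term>\<open>y\<close>, among them the block of \<^term>\<open>v\<close>.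
\<close>

lemma cross_arc_forward:
  assumes "x \<in> V" "y \<in> V" "(x, y) \<in> E" "index x \<le> m" "m < index y"
  shows "(orbit m, y) \<in> E"
proof (rule orbit_dominates_later[of "index x"])
  show "(orbit (index x), y) \<in> E"
    by (rule index_out[OF assms(1-3)]) (use assms in auto)
  show "block y \<noteq> block (orbit l)" if "index x \<le> l" "l \<le> m" for l
  proof
    assume "block y = block (orbit l)"
    then have "index y = l" using index_eqI[of y l] index(1)[of y] that assms by linarith
    with that assms show False by linarith
  qed
qed (use assms in auto)

lemma cross_arc_backward:
  assumes "x \<in> V" "y \<in> V" "(x, y) \<in> E" "index y < index x" "m < index y"
  shows "(orbit m, y) \<in> E"
proof -
  have ne: "block y \<noteq> block (orbit l)" if "l < period" "l \<noteq> index y" for l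
    using that index_eqI[OF assms(2), of l] by auto
  have "(orbit period, y) \<in> E"
  proof (rule orbit_dominates_later[of "index x"])
    show "(orbit (index x), y) \<in> E"
      by (rule index_out[OF assms(1-3)]) (use assms in auto)
    show "block y \<noteq> block (orbit l)" if "index x \<le> l" "l \<le> period" for l
    proof (cases "l = period")
      case True
      then show ?thesis using ne[of 0] assms(5) period by simp
    next
      case False
      then show ?thesis using that assms(4) by (intro ne) auto
    qed
  qed (use assms(2) index(1)[OF assms(1)] in auto)
  moreover have "block (orbit period) \<noteq> block y"
    using ne[of 0] period assms(5) by (metis not_less_zero orbit_0)
  ultimately have "(v, y) \<in> E"
    using block_out[OF orbit_in assms(2) _ _ v_in] period(2) by metis
  then show ?thesis
    using cross_arc_forward[OF v_in assms(2)] assms(5) by simp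
qed

text \<open>
  The previous block dominates every vertex at which a block is entered, and the orbit vertex of the
  block is the source of the out-neighbours of the previous block.
\<close>

lemma cross_arc_enters_out_neighborhood:
  assumes "x \<in> V" "y \<in> V" "(x, y) \<in> E" "index x \<noteq> index y" "index y > 0"
  shows "y = orbit (index y) \<or> (orbit (index y), y) \<in> E"
proof -
  obtain m where m: "index y = Suc m" using assms(5) by (cases "index y") auto
  have "(orbit m, y) \<in> E"
  proof (cases "index x < index y")
    case True
    then show ?thesis using cross_arc_forward[OF assms(1-3)] m by simp
  next
    case False
    then show ?thesis using cross_arc_backward[OF assms(1-3)] assms(4) m by simp
  qed
  moreover have "block y \<noteq> block (orbit m)"
    using index_eqI[OF assms(2), of m] index(1)[OF assms(2)] m by auto
  ultimately show ?thesis
    using next_vertex_source(4)[of "orbit m" y] assms m by (simp add: orbit_Suc)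
qed

text \<open>
  The colour for the vertices at which the block with a given index is entered. Red blocks are the
  block of \<^term>\<open>v\<close> and its out-neighbours when each block is contracted to a vertex.
\<close>

definition red :: "nat \<Rightarrow> bool" where
  "red i \<longleftrightarrow> i = 0 \<or> (\<exists>z\<in>V. index z = i \<and> (v, z) \<in> E)"

text \<open>
  Contracted to vertices, the blocks would otherwise contain a digon; by the common out-neighbours of
  a block it becomes a digon between single vertices.
\<close>

lemma no_arc_back_from_red:
  assumes "x \<in> V" "y \<in> V" "(x, y) \<in> E" "index y < index x"
  shows "\<not> red (index x)"
proof
  assume "red (index x)"
  then obtain z where z: "z \<in> V" "index z = index x" "(v, z) \<in> E"
    using assms(4) unfolding red_def by auto
  have "(orbit (index y), z) \<in> E"
    using cross_arc_forward[OF v_in z(1,3)] z(2) assms(4) by simp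
  then have "(y, z) \<in> E"
    by (rule index_out[OF orbit_in z(1)]) (use z(2) assms in auto)
  moreover have "(z, y) \<in> E"
    by (rule index_out[OF assms(1-3)]) (use z assms(4) in auto)
  ultimately show False using no_digon by blast
qed

text \<open>
  Each block keeps its colouring up to exchanging the two colours, which is decided so that its orbit
  vertex and hence its entries get the colour of the block. The block of \<^term>\<open>v\<close> is an exception:
  its entries may have both colours, since the root of its colouring is \<^term>\<open>v\<close>. Blue paths
  nevertheless cannot traverse it, for all arcs leaving it end in red vertices.
\<close>

lemma glue_block_colorings:
  assumes col: "\<And>i. i < period \<Longrightarrow> acyclic_bicoloring E (block (orbit i)) (g i)"
    and root: "\<And>i. i < period \<Longrightarrow> g i (orbit i)"
    and out: "\<And>i y. i < period \<Longrightarrow> y \<in> block (orbit i) \<Longrightarrow> (orbit i, y) \<in> E \<Longrightarrow> g i y"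
  shows "\<exists>c. acyclic_bicoloring E V c \<and> c v \<and> (\<forall>y\<in>V. (v, y) \<in> E \<longrightarrow> c y)"
proof -
  define c where "c x = (g (index x) x = red (index x))" for x
  have entry: "c y = red (index y)"
    if "x \<in> V" "y \<in> V" "(x, y) \<in> E" "index x \<noteq> index y" "index y > 0" for x y
    using cross_arc_enters_out_neighborhood[OF that] root[of "index y"] out[of "index y" y]
      index[of y] that(2) in_block_iff[of "orbit (index y)" y] unfolding c_def by auto
  have "c v" using root[of 0] period by (simp add: c_def red_def)
  moreover have "c y" if y: "y \<in> V" "(v, y) \<in> E" for y
  proof (cases "index y = 0")
    case True
    then have "block y = block v" using index[of y] y by simp
    then show ?thesis
      using out[of 0 y] period y True in_block_iff[of v y] v_in by (simp add: c_def red_def)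
  next
    case False
    then show ?thesis using entry[of v y] y v_in by (auto simp: red_def)
  qed
  moreover have "acyclic_bicoloring E V c"
    \<comment> \<open>Red arcs between blocks end in red blocks, so the others get the least red rank. Blue arcs
        between blocks do not start in the block of \<open>v\<close>, so it gets the greatest blue rank.\<close>
  proof (rule acyclic_bicoloring_by_blocks[where p = index and
      r = "\<lambda>b i. if b then (if red i then Suc i else 0) else (if i = 0 then period else i)"])
    show "acyclic_bicoloring E {x \<in> V. index x = i} c" for i
    proof (cases "i < period")
      case True
      then have "{x \<in> V. index x = i} = block (orbit i)"
        using index_eqI index in_block_iff[OF orbit_in[of i]] block_subset[OF orbit_in[of i]] by blast
      then show ?thesis
        using acyclic_bicoloring_flip_cong[OF col[OF True], of c "red i"] unfolding c_def
        by (metis (mono_tags, lifting) mem_Collect_eq)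
    next
      case False
      then have empty_block: "{x \<in> V. index x = i} = {}" using index by auto
      show ?thesis unfolding empty_block by (simp add: acyclic_bicoloring_def acyclic_def)
    qed
    fix x y assume xy: "x \<in> V" "y \<in> V" "(x, y) \<in> E" "c x = c y" "index x \<noteq> index y"
    \<comment> \<open>So a red arc to an earlier block starts in a block of rank 0.\<close>
    have backward: "\<not> red (index x)" if "index y < index x"
      using no_arc_back_from_red[OF xy(1-3) that] .
    \<comment> \<open>So a blue arc into a block other than that of \<open>v\<close> leads from a smaller positive index to a
        larger one.\<close>
    have red_y: "red (index y)" if "index x = 0 \<or> index y < index x"
    proof (cases "index y = 0")
      case False
      then have "(v, y) \<in> E"
        using cross_arc_forward[of x y 0] cross_arc_backward[of x y 0] xy that by auto
      then show ?thesis using xy unfolding red_def by blast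
    qed (simp add: red_def)
    have le: "index x < period" using index xy by blast
    show "(if c x then (if red (index x) then Suc (index x) else 0)
             else (if index x = 0 then period else index x))
        < (if c x then (if red (index y) then Suc (index y) else 0)
             else (if index y = 0 then period else index y))"
    proof (cases "index y = 0")
      case True
      then show ?thesis using xy(5) backward le by (auto simp: red_def)
    next
      case False
      then have "c x = red (index y)" using entry[OF xy(1-3,5)] xy(4) by simp
      then show ?thesis using False xy(5) backward red_y
        by (cases rule: linorder_cases[of "index x" "index y"]) auto
    qed
  qed
  ultimately show ?thesis by blast
qed

end

section \<open>Two colours suffice\<close>

text \<open>
  The colour of the closed out-neighbourhood is prescribed for the sake of the induction: in a strong
  digraph every block, except that of \<^term>\<open>v\<close>, is entered only within the closed out-neighbourhood
  of its orbit vertex, so only cycles of one colour can enter it.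
\<close>

lemma (in transitive_out_neighborhoods) bicoloring_exists:
  assumes "finite V" "v \<in> V"
  shows "\<exists>c. acyclic_bicoloring E V c \<and> c v \<and> (\<forall>y\<in>V. (v, y) \<in> E \<longrightarrow> c y)"
  using assms
proof (induction V arbitrary: v rule: finite_psubset_induct)
  case (psubset V)
  consider "V = {v}" | "\<not> strong E V" | "V \<noteq> {v}" "strong E V" by blast
  then show ?case
  proof cases
    case 1
    have "Restr E {v} = {}" using no_digon by auto
    moreover have "Restr E {x \<in> V. True = b} \<subseteq> Restr E {v}" for b using 1 by auto
    ultimately have "acyclic_bicoloring E V (\<lambda>_. True)"
      unfolding acyclic_bicoloring_def acyclic_def by (metis subset_empty trancl_empty empty_iff)
    then show ?thesis by blast
  next
    case 2
    then obtain B where B: "B \<noteq> {}" "B \<subset> V" and "\<not> (\<exists>y\<in>B. \<exists>z\<in>V - B. (y, z) \<in> E)"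
      unfolding strong_def by blast
    then have closed: "z \<in> B" if "y \<in> B" "z \<in> V" "(y, z) \<in> E" for y z
      using that by blast
    have rest: "V - B \<subset> V" "V - B \<noteq> {}" using B by auto
    have glue: "acyclic_bicoloring E V (\<lambda>x. if x \<in> B then g x else h x)"
      if "acyclic_bicoloring E B g" "acyclic_bicoloring E (V - B) h" for g h
    proof (rule acyclic_bicoloring_by_blocks[where p = "\<lambda>x. x \<in> B" and r = "\<lambda>_. of_bool"])
      show "acyclic_bicoloring E {x \<in> V. (x \<in> B) = i} (\<lambda>x. if x \<in> B then g x else h x)" for i
      proof (cases i)
        case True
        then have "{x \<in> V. (x \<in> B) = i} = B" using B by auto
        then show ?thesis using acyclic_bicoloring_flip_cong[OF that(1), where b = True] by simp
      next
        case False
        then have "{x \<in> V. (x \<in> B) = i} = V - B" by auto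
        then show ?thesis using acyclic_bicoloring_flip_cong[OF that(2), where b = True] by simp
      qed
    qed (use closed in auto)
    show ?thesis
    proof (cases "v \<in> B")
      case True
      obtain w where "w \<in> V - B" using rest by blast
      with psubset.IH[OF rest(1)] obtain h where "acyclic_bicoloring E (V - B) h" by blast
      moreover obtain g where "acyclic_bicoloring E B g" "g v" "\<forall>y\<in>B. (v, y) \<in> E \<longrightarrow> g y"
        using psubset.IH[OF B(2) True] by blast
      ultimately show ?thesis
        using glue[of g h] True closed by (intro exI[of _ "\<lambda>x. if x \<in> B then g x else h x"]) auto
    next
      case False
      then obtain h where h: "acyclic_bicoloring E (V - B) h" "h v"
          "\<forall>y\<in>V - B. (v, y) \<in> E \<longrightarrow> h y"
        using psubset.IH[OF rest(1), of v] psubset.prems by blast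
      \<comment> \<open>A root in \<open>B\<close> whose closed out-neighbourhood contains all out-neighbours of \<open>v\<close> in \<open>B\<close>.\<close>
      have "\<exists>u\<in>B. \<forall>y\<in>B. (v, y) \<in> E \<longrightarrow> y = u \<or> (u, y) \<in> E"
      proof (cases "B \<inter> E `` {v} = {}")
        case True
        then show ?thesis using B by blast
      next
        case False
        then show ?thesis
          using out_source_exists[of "B \<inter> E `` {v}" v] B psubset.hyps finite_subset by blast
      qed
      then obtain u where u: "u \<in> B" "\<And>y. y \<in> B \<Longrightarrow> (v, y) \<in> E \<Longrightarrow> y = u \<or> (u, y) \<in> E"
        by blast
      obtain g where "acyclic_bicoloring E B g" "g u" "\<forall>y\<in>B. (u, y) \<in> E \<longrightarrow> g y"
        using psubset.IH[OF B(2) u(1)] by blast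
      then show ?thesis
        using glue[of g h] h u False by (intro exI[of _ "\<lambda>x. if x \<in> B then g x else h x"]) auto
    qed
  next
    case 3
    then interpret rooted_strong E V v
      using psubset.hyps psubset.prems by unfold_locales auto
    have "\<exists>c. acyclic_bicoloring E (block (orbit i)) c \<and> c (orbit i) \<and>
            (\<forall>y\<in>block (orbit i). (orbit i, y) \<in> E \<longrightarrow> c y)" for i
      using psubset.IH[OF block_subset block_maximal(2)] orbit_in by blast
    then obtain g where "\<And>i. acyclic_bicoloring E (block (orbit i)) (g i) \<and> g i (orbit i) \<and>
            (\<forall>y\<in>block (orbit i). (orbit i, y) \<in> E \<longrightarrow> g i y)" by metis
    then show ?thesis using glue_block_colorings[of g] by blast
  qed
qed

section \<open>Forbidden induced subdigraphs as conditions on arcs\<close>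

lemma acyclic_digraph_induced_iff:
  assumes "pair_wf_digraph D"
  shows "acyclic_digraph (with_proj D \<restriction> A) \<longleftrightarrow> acyclic (Restr (parcs D) A)"
proof -
  interpret pair_wf_digraph D by (rule assms)
  interpret A: wf_digraph "with_proj D \<restriction> A" by (rule wellformed_induce_subgraph)
  have ends: "arcs_ends (with_proj D \<restriction> A) = Restr (parcs D) A"
    by (auto simp: arcs_ends_conv induce_subgraph_def with_proj_def)
  have "(\<exists>p. A.cycle p) \<longleftrightarrow> (\<exists>u. (u, u) \<in> (arcs_ends (with_proj D \<restriction> A))\<^sup>+)"
  proof
    assume "\<exists>p. A.cycle p"
    then show "\<exists>u. (u, u) \<in> (arcs_ends (with_proj D \<restriction> A))\<^sup>+"
      unfolding A.cycle_def A.reachable1_awalk by blast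
  next
    assume "\<exists>u. (u, u) \<in> (arcs_ends (with_proj D \<restriction> A))\<^sup>+"
    then obtain p where "A.closed_w p" unfolding A.closed_w_def A.reachable1_awalk by blast
    then show "\<exists>p. A.cycle p" by (rule A.closed_w_imp_cycle)
  qed
  then show ?thesis unfolding acyclic_digraph_def acyclic_def ends by blast
qed

text \<open>
  Since arcs are pairs of vertices, an isomorphism onto an induced subdigraph is determined by its
  vertex map.
\<close>

lemma induced_copy_iff:
  assumes F: "pair_wf_digraph F"
  shows "(\<exists>X\<subseteq>pverts D. digraph_iso (with_proj F) (with_proj D \<restriction> X)) \<longleftrightarrow>
    (\<exists>h. inj_on h (pverts F) \<and> h ` pverts F \<subseteq> pverts D \<and>
       (\<forall>u\<in>pverts F. \<forall>v\<in>pverts F. (u, v) \<in> parcs F \<longleftrightarrow> (h u, h v) \<in> parcs D))"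
    (is "?copy \<longleftrightarrow> ?emb")
proof
  interpret F: pair_wf_digraph F by (rule F)
  assume ?copy
  then obtain X f where X: "X \<subseteq> pverts D" and f: "F.digraph_isomorphism f"
      and eq: "with_proj D \<restriction> X = app_iso f (with_proj F)"
    unfolding digraph_iso_def by blast
  let ?h = "iso_verts f"
  have verts: "?h ` pverts F = X" using arg_cong[OF eq, of verts] by simp
  have arcs: "iso_arcs f ` parcs F = Restr (parcs D) X"
  proof -
    have "Restr (parcs D) X = arcs (with_proj D \<restriction> X)" by (auto simp: induce_subgraph_def)
    then show ?thesis using eq by simp
  qed
  have ends: "iso_tail f = fst" "iso_head f = snd"
    using arg_cong[OF eq, of tail] arg_cong[OF eq, of head] by simp_all
  have inj: "inj_on ?h (pverts F)" using f by (simp add: F.digraph_isomorphism_def)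
  have arc: "iso_arcs f (u, v) = (?h u, ?h v)" if "(u, v) \<in> parcs F" for u v
    using f that ends unfolding F.digraph_isomorphism_def
    by (metis fst_conv prod.collapse snd_conv)
  have "(u, v) \<in> parcs F \<longleftrightarrow> (?h u, ?h v) \<in> parcs D"
    if uv: "u \<in> pverts F" "v \<in> pverts F" for u v
  proof
    assume "(u, v) \<in> parcs F"
    then show "(?h u, ?h v) \<in> parcs D" using arcs arc by force
  next
    assume "(?h u, ?h v) \<in> parcs D"
    then have "(?h u, ?h v) \<in> iso_arcs f ` parcs F" using arcs verts uv by auto
    then obtain a b where ab: "(a, b) \<in> parcs F" and "iso_arcs f (a, b) = (?h u, ?h v)"
      by force
    then have "?h a = ?h u" "?h b = ?h v" using arc[OF ab] by auto
    then show "(u, v) \<in> parcs F"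
      using inj uv ab F.in_arcsD1[OF ab] F.in_arcsD2[OF ab] by (metis inj_onD)
  qed
  with inj verts X show ?emb by (intro exI[of _ ?h]) auto
next
  interpret F: pair_wf_digraph F by (rule F)
  assume ?emb
  then obtain h where h: "inj_on h (pverts F)" "h ` pverts F \<subseteq> pverts D"
      "\<And>u v. u \<in> pverts F \<Longrightarrow> v \<in> pverts F \<Longrightarrow> (u, v) \<in> parcs F \<longleftrightarrow> (h u, h v) \<in> parcs D"
    by blast
  let ?f = "\<lparr>iso_verts = h, iso_arcs = map_prod h h, iso_head = snd, iso_tail = fst\<rparr>"
  have "inj_on (map_prod h h) (parcs F)"
    by (rule inj_on_subset[OF map_prod_inj_on[OF h(1) h(1)]])
      (use F.in_arcsD1 F.in_arcsD2 in auto)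
  then have "F.digraph_isomorphism ?f"
    using h(1) F.wf_digraph_axioms by (auto simp: F.digraph_isomorphism_def)
  moreover have "map_prod h h ` parcs F = Restr (parcs D) (h ` pverts F)"
  proof (intro equalityI subsetI)
    fix e assume "e \<in> map_prod h h ` parcs F"
    then obtain u v where "(u, v) \<in> parcs F" "e = (h u, h v)" by auto
    then show "e \<in> Restr (parcs D) (h ` pverts F)"
      using h(3)[of u v] F.in_arcsD1[of u v] F.in_arcsD2[of u v] by auto
  next
    fix e assume "e \<in> Restr (parcs D) (h ` pverts F)"
    then obtain u v where uv: "u \<in> pverts F" "v \<in> pverts F" "e = (h u, h v)" "e \<in> parcs D"
      by auto
    then have "(u, v) \<in> parcs F" using h(3) by simp
    with uv(3) show "e \<in> map_prod h h ` parcs F" by force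
  qed
  then have "with_proj D \<restriction> (h ` pverts F) = app_iso ?f (with_proj F)"
    by (auto simp: app_iso_def induce_subgraph_def)
  ultimately show ?copy using h(2) unfolding digraph_iso_def by blast
qed

lemma induced_copy_on_3_vertices_iff:
  assumes F: "pair_wf_digraph F" "pverts F = {0, 1, 2 :: nat}"
  shows "(\<exists>X\<subseteq>pverts D. digraph_iso (with_proj F) (with_proj D \<restriction> X)) \<longleftrightarrow>
    (\<exists>x y z. {x, y, z} \<subseteq> pverts D \<and> distinct [x, y, z] \<and>
       (\<forall>i\<in>{0, 1, 2}. \<forall>j\<in>{0, 1, 2}. (i, j) \<in> parcs F \<longleftrightarrow> ([x, y, z] ! i, [x, y, z] ! j) \<in> parcs D))"
    (is "?copy \<longleftrightarrow> ?triple")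
proof
  assume ?copy
  then obtain h where "inj_on h {0, 1, 2}" "h ` {0, 1, 2} \<subseteq> pverts D"
      "\<forall>i\<in>{0, 1, 2}. \<forall>j\<in>{0, 1, 2}. (i, j) \<in> parcs F \<longleftrightarrow> (h i, h j) \<in> parcs D"
    unfolding induced_copy_iff[OF F(1)] F(2) by blast
  then show ?triple
    by (intro exI[of _ "h 0"] exI[of _ "h 1"] exI[of _ "h 2"]) simp
next
  assume ?triple
  then obtain x y z where "{x, y, z} \<subseteq> pverts D" "distinct [x, y, z]"
      "\<forall>i\<in>{0, 1, 2}. \<forall>j\<in>{0, 1, 2}. (i, j) \<in> parcs F \<longleftrightarrow> ([x, y, z] ! i, [x, y, z] ! j) \<in> parcs D"
    by blast
  then show ?copy
    unfolding induced_copy_iff[OF F(1)] F(2) by (intro exI[of _ "(!) [x, y, z]"]) simp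
qed

lemma pattern_digraphs_wf:
  "pair_wf_digraph digon" "pair_wf_digraph out_star_2"
  "pair_wf_digraph in_star_2" "pair_wf_digraph directed_triangle"
  by unfold_locales (auto simp: digon_def out_star_2_def in_star_2_def directed_triangle_def)

context
  fixes D :: "'a pair_pre_digraph"
  assumes D: "pair_digraph D"
begin

interpretation pair_digraph D by (rule D)

lemma loopless: "(x, x) \<notin> parcs D"
  using pair_no_loops by fastforce

lemma induced_digon_iff:
  "(\<exists>X\<subseteq>pverts D. digraph_iso (with_proj digon) (with_proj D \<restriction> X)) \<longleftrightarrow>
   (\<exists>x y. (x, y) \<in> parcs D \<and> (y, x) \<in> parcs D)"
  unfolding induced_copy_iff[OF pattern_digraphs_wf(1)]
proof
  assume "\<exists>x y. (x, y) \<in> parcs D \<and> (y, x) \<in> parcs D"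
  then obtain x y where xy: "(x, y) \<in> parcs D" "(y, x) \<in> parcs D" by blast
  then have "x \<noteq> y" "x \<in> pverts D" "y \<in> pverts D" using loopless in_arcsD1 by blast+
  with xy show "\<exists>h. inj_on h (pverts digon) \<and> h ` pverts digon \<subseteq> pverts D \<and>
     (\<forall>u\<in>pverts digon. \<forall>v\<in>pverts digon. (u, v) \<in> parcs digon \<longleftrightarrow> (h u, h v) \<in> parcs D)"
    by (intro exI[of _ "(!) [x, y]"]) (simp add: digon_def loopless)
qed (auto simp: digon_def)

lemma induced_out_star_iff:
  assumes "asym (parcs D)"
  shows "(\<exists>X\<subseteq>pverts D. digraph_iso (with_proj out_star_2) (with_proj D \<restriction> X)) \<longleftrightarrow>
   (\<exists>x y z. (x, y) \<in> parcs D \<and> (x, z) \<in> parcs D \<and> y \<noteq> z \<and> (y, z) \<notin> parcs D \<and> (z, y) \<notin> parcs D)"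
proof -
  have "pverts out_star_2 = {0, 1, 2}" by (simp add: out_star_2_def)
  note copy = induced_copy_on_3_vertices_iff[OF pattern_digraphs_wf(2) this, of D]
  show ?thesis
    unfolding copy
    by (simp add: out_star_2_def loopless) (use asymD[OF assms] loopless in_arcsD1 in_arcsD2 in blast)
qed

lemma induced_in_star_iff:
  assumes "asym (parcs D)"
  shows "(\<exists>X\<subseteq>pverts D. digraph_iso (with_proj in_star_2) (with_proj D \<restriction> X)) \<longleftrightarrow>
   (\<exists>x y z. (y, x) \<in> parcs D \<and> (z, x) \<in> parcs D \<and> y \<noteq> z \<and> (y, z) \<notin> parcs D \<and> (z, y) \<notin> parcs D)"
proof -
  have "pverts in_star_2 = {0, 1, 2}" by (simp add: in_star_2_def)
  note copy = induced_copy_on_3_vertices_iff[OF pattern_digraphs_wf(3) this, of D]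
  show ?thesis
    unfolding copy
    by (simp add: in_star_2_def loopless) (use asymD[OF assms] loopless in_arcsD1 in_arcsD2 in blast)
qed

lemma induced_triangle_iff:
  assumes "asym (parcs D)"
  shows "(\<exists>X\<subseteq>pverts D. digraph_iso (with_proj directed_triangle) (with_proj D \<restriction> X)) \<longleftrightarrow>
   (\<exists>x y z. (x, y) \<in> parcs D \<and> (y, z) \<in> parcs D \<and> (z, x) \<in> parcs D)"
proof -
  have "pverts directed_triangle = {0, 1, 2}" by (simp add: directed_triangle_def)
  note copy = induced_copy_on_3_vertices_iff[OF pattern_digraphs_wf(4) this, of D]
  show ?thesis
    unfolding copy
    by (simp add: directed_triangle_def loopless) (use asymD[OF assms] loopless in_arcsD1 in_arcsD2 in blast)
qed

end

definition triangle_free_oriented :: "'a rel \<Rightarrow> bool" where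
  "triangle_free_oriented A \<longleftrightarrow> asym A \<and> (\<forall>x y z. (x, y) \<in> A \<longrightarrow> (y, z) \<in> A \<longrightarrow> (z, x) \<notin> A)"

definition out_tournaments :: "'a rel \<Rightarrow> bool" where
  "out_tournaments A \<longleftrightarrow> (\<forall>x y z. (x, y) \<in> A \<longrightarrow> (x, z) \<in> A \<longrightarrow> y = z \<or> (y, z) \<in> A \<or> (z, y) \<in> A)"

text \<open>
  Without digons an induced star with two leaves is a pair of nonadjacent out-neighbours, and every
  directed triangle is induced. With a digon both sides of the equivalence fail.
\<close>

lemma Forb_ind_out_star_iff:
  "D \<in> Forb_ind {digon, out_star_2, directed_triangle} \<longleftrightarrow>
   pair_digraph D \<and> triangle_free_oriented (parcs D) \<and> out_tournaments (parcs D)"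
proof (cases "pair_digraph D")
  case D: True
  have Forb: "D \<in> Forb_ind {digon, out_star_2, directed_triangle} \<longleftrightarrow>
      \<not> (\<exists>X\<subseteq>pverts D. digraph_iso (with_proj digon) (with_proj D \<restriction> X)) \<and>
      \<not> (\<exists>X\<subseteq>pverts D. digraph_iso (with_proj out_star_2) (with_proj D \<restriction> X)) \<and>
      \<not> (\<exists>X\<subseteq>pverts D. digraph_iso (with_proj directed_triangle) (with_proj D \<restriction> X))"
    using D by (simp add: Forb_ind_def)
  show ?thesis
  proof (cases "asym (parcs D)")
    case True
    have "\<not> (\<exists>X\<subseteq>pverts D. digraph_iso (with_proj out_star_2) (with_proj D \<restriction> X))
        \<longleftrightarrow> out_tournaments (parcs D)"
      unfolding induced_out_star_iff[OF D True] out_tournaments_def converse_iff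
      unfolding not_ex by (intro iff_allI) blast
    moreover have "\<not> (\<exists>X\<subseteq>pverts D. digraph_iso (with_proj directed_triangle) (with_proj D \<restriction> X))
        \<longleftrightarrow> triangle_free_oriented (parcs D)"
      unfolding induced_triangle_iff[OF D True] triangle_free_oriented_def
      unfolding not_ex eqTrueI[OF True] simp_thms by (intro iff_allI) blast
    moreover have "\<not> (\<exists>X\<subseteq>pverts D. digraph_iso (with_proj digon) (with_proj D \<restriction> X))"
      unfolding induced_digon_iff[OF D] using asymD[OF True] by blast
    ultimately show ?thesis unfolding Forb using D by argo
  next
    case False
    then have "\<exists>X\<subseteq>pverts D. digraph_iso (with_proj digon) (with_proj D \<restriction> X)"
      unfolding induced_digon_iff[OF D] by (meson asymI)
    with False show ?thesis unfolding Forb triangle_free_oriented_def by argo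
  qed
qed (simp add: Forb_ind_def)

lemma Forb_ind_in_star_iff:
  "D \<in> Forb_ind {digon, in_star_2, directed_triangle} \<longleftrightarrow>
   pair_digraph D \<and> triangle_free_oriented (parcs D) \<and> out_tournaments ((parcs D)\<inverse>)"
proof (cases "pair_digraph D")
  case D: True
  have Forb: "D \<in> Forb_ind {digon, in_star_2, directed_triangle} \<longleftrightarrow>
      \<not> (\<exists>X\<subseteq>pverts D. digraph_iso (with_proj digon) (with_proj D \<restriction> X)) \<and>
      \<not> (\<exists>X\<subseteq>pverts D. digraph_iso (with_proj in_star_2) (with_proj D \<restriction> X)) \<and>
      \<not> (\<exists>X\<subseteq>pverts D. digraph_iso (with_proj directed_triangle) (with_proj D \<restriction> X))"
    using D by (simp add: Forb_ind_def)
  show ?thesis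
  proof (cases "asym (parcs D)")
    case True
    have "\<not> (\<exists>X\<subseteq>pverts D. digraph_iso (with_proj in_star_2) (with_proj D \<restriction> X))
        \<longleftrightarrow> out_tournaments ((parcs D)\<inverse>)"
      unfolding induced_in_star_iff[OF D True] out_tournaments_def converse_iff
      unfolding not_ex by (intro iff_allI) blast
    moreover have "\<not> (\<exists>X\<subseteq>pverts D. digraph_iso (with_proj directed_triangle) (with_proj D \<restriction> X))
        \<longleftrightarrow> triangle_free_oriented (parcs D)"
      unfolding induced_triangle_iff[OF D True] triangle_free_oriented_def
      unfolding not_ex eqTrueI[OF True] simp_thms by (intro iff_allI) blast
    moreover have "\<not> (\<exists>X\<subseteq>pverts D. digraph_iso (with_proj digon) (with_proj D \<restriction> X))"
      unfolding induced_digon_iff[OF D] using asymD[OF True] by blast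
    ultimately show ?thesis unfolding Forb using D by argo
  next
    case False
    then have "\<exists>X\<subseteq>pverts D. digraph_iso (with_proj digon) (with_proj D \<restriction> X)"
      unfolding induced_digon_iff[OF D] by (meson asymI)
    with False show ?thesis unfolding Forb triangle_free_oriented_def by argo
  qed
qed (simp add: Forb_ind_def)

section \<open>Dichromatic numbers\<close>

lemma triangle_free_oriented_converse: "triangle_free_oriented A \<Longrightarrow> triangle_free_oriented (A\<inverse>)"
  unfolding triangle_free_oriented_def asym_iff converse_iff by blast

lemma out_tournaments_bicoloring:
  assumes "finite V" "triangle_free_oriented A" "out_tournaments A"
  shows "\<exists>c. acyclic_bicoloring A V c"
proof (cases "V = {}")
  case True
  then show ?thesis by (auto simp: acyclic_bicoloring_def acyclic_def)
next
  case False
  interpret transitive_out_neighborhoods A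
  proof
    show "(y, x) \<notin> A" if "(x, y) \<in> A" for x y
      using asymD assms(2) that unfolding triangle_free_oriented_def by metis
    show "(y, z) \<in> A \<or> (z, y) \<in> A" if "(x, y) \<in> A" "(x, z) \<in> A" "y \<noteq> z" for x y z
      using assms(3) that unfolding out_tournaments_def by blast
    show "(d, a) \<notin> A" if "(a, b) \<in> A" "(b, d) \<in> A" for a b d
      using assms(2) that unfolding triangle_free_oriented_def by blast
  qed
  obtain v where "v \<in> V" using False by blast
  from bicoloring_exists[OF assms(1) this] show ?thesis by blast
qed

lemma acyclic_bicoloring_converse: "acyclic_bicoloring (A\<inverse>) V c \<longleftrightarrow> acyclic_bicoloring A V c"
proof -
  have "Restr (A\<inverse>) X = (Restr A X)\<inverse>" for X by auto
  then show ?thesis by (simp add: acyclic_bicoloring_def acyclic_converse)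
qed

lemma acyclic_colorable_2:
  assumes "pair_digraph D" "acyclic_bicoloring (parcs D) (pverts D) c"
  shows "acyclic_colorable D 2"
proof -
  interpret pair_digraph D by (rule assms(1))
  have "acyclic (Restr (parcs D) {v \<in> pverts D. of_bool (c v) = i})" if "i \<in> {0, 1::nat}" for i
  proof -
    have "{v \<in> pverts D. of_bool (c v) = i} = {v \<in> pverts D. c v = (i = 1)}"
      using that by auto
    then show ?thesis using assms(2) by (simp add: acyclic_bicoloring_def)
  qed
  then have "acyclic_coloring D {0, 1::nat} (\<lambda>v. of_bool (c v))"
    by (auto simp: acyclic_coloring_def acyclic_digraph_induced_iff[OF pair_wf_digraph_axioms])
  then show ?thesis unfolding acyclic_colorable_def
    by (intro exI[of _ "{0, 1::nat}"] exI[of _ "\<lambda>v. of_bool (c v)"]) simp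
qed

lemma acyclic_colorable_ge_2:
  assumes "pair_digraph D" "\<not> acyclic (Restr (parcs D) (pverts D))" "acyclic_colorable D k"
  shows "k \<ge> 2"
proof (rule ccontr)
  assume "\<not> k \<ge> 2"
  interpret pair_digraph D by (rule assms(1))
  obtain S :: "nat set" and c where S: "finite S" "card S = k" "acyclic_coloring D S c"
    using assms(3) unfolding acyclic_colorable_def by blast
  have "pverts D \<noteq> {}" using assms(2) by (auto simp: acyclic_def)
  then obtain v where v: "v \<in> pverts D" by blast
  have cS: "c x \<in> S" if "x \<in> pverts D" for x
    using that S(3) unfolding acyclic_coloring_def by auto
  have "S = {c v}"
    using S(1,2) cS[OF v] \<open>\<not> k \<ge> 2\<close> card_le_Suc0_iff_eq[OF S(1)] by force
  then have "{x \<in> pverts D. c x = c v} = pverts D" using cS by auto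
  moreover have "acyclic (Restr (parcs D) {x \<in> pverts D. c x = c v})"
    using S(3) cS[OF v] unfolding acyclic_coloring_def
    by (simp add: acyclic_digraph_induced_iff[OF pair_wf_digraph_axioms])
  ultimately show False using assms(2) by simp
qed

text \<open>
  Every vertex has one out-neighbour and one in-neighbour, so both tournament conditions hold
  trivially.
\<close>

lemma directed_4_cycle_exists:
  obtains D :: "'a :: infinite pair_pre_digraph"
  where "pair_digraph D" "triangle_free_oriented (parcs D)" "out_tournaments (parcs D)"
    "out_tournaments ((parcs D)\<inverse>)" "\<not> acyclic (Restr (parcs D) (pverts D))"
proof -
  obtain f :: "nat \<Rightarrow> 'a" where "inj f"
    using infinite_countable_subset[OF infinite_UNIV] by blast
  then have ne: "f i = f j \<longleftrightarrow> i = j" for i j by (simp add: inj_eq)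
  define D where "D = \<lparr>pverts = {f 0, f 1, f 2, f 3},
    parcs = {(f 0, f 1), (f 1, f 2), (f 2, f 3), (f 3, f 0)}\<rparr>"
  have "Restr (parcs D) (pverts D) = {(f 0, f 1), (f 1, f 2), (f 2, f 3), (f 3, f 0)}"
    by (auto simp: D_def)
  moreover have "(f 0, f 0) \<in> {(f 0, f 1), (f 1, f 2), (f 2, f 3), (f 3, f 0)}\<^sup>+"
    by (rule trancl_into_trancl[of _ "f 3"], rule trancl_into_trancl[of _ "f 2"],
        rule trancl_into_trancl[of _ "f 1"]) auto
  ultimately have "\<not> acyclic (Restr (parcs D) (pverts D))" unfolding acyclic_def by metis
  moreover have "pair_digraph D" by unfold_locales (auto simp: D_def ne)
  moreover have "triangle_free_oriented (parcs D)" "out_tournaments (parcs D)"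
      "out_tournaments ((parcs D)\<inverse>)"
    by (auto simp: D_def ne triangle_free_oriented_def out_tournaments_def)
  ultimately show ?thesis using that by blast
qed

lemma max_dichromatic_number_eq_2:
  assumes upper: "\<And>D. D \<in> \<C> \<Longrightarrow> acyclic_colorable D 2"
    and lower: "D \<in> \<C>" "pair_digraph D" "\<not> acyclic (Restr (parcs D) (pverts D))"
  shows "bdd_above (dichromatic_number ` \<C>) \<and> max_dichromatic_number \<C> = 2"
proof -
  have le: "dichromatic_number D' \<le> 2" if "D' \<in> \<C>" for D'
    unfolding dichromatic_number_def using upper[OF that] by (rule Least_le)
  have "dichromatic_number D = 2"
    unfolding dichromatic_number_def
    using upper[OF lower(1)] acyclic_colorable_ge_2[OF lower(2,3)] by (rule Least_equality)
  then have "2 \<in> dichromatic_number ` \<C>" using lower(1) by force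
  moreover have "finite (dichromatic_number ` \<C>)"
    by (rule finite_subset[of _ "{..2}"]) (use le in auto)
  ultimately have "max_dichromatic_number \<C> = 2"
    unfolding max_dichromatic_number_def by (intro Max_eqI) (use le in auto)
  moreover have "bdd_above (dichromatic_number ` \<C>)" using le by (rule bdd_aboveI2)
  ultimately show ?thesis by blast
qed

lemma finite_pverts: "pair_digraph D \<Longrightarrow> finite (pverts D)"
  by (simp add: pair_digraph_def pair_fin_digraph_def pair_fin_digraph_axioms_def)

theorem theorem1:
  shows "bdd_above (dichromatic_number `
           (Forb_ind {digon, out_star_2, directed_triangle} :: 'a :: infinite pair_pre_digraph set)) \<and>
         max_dichromatic_number
           (Forb_ind {digon, out_star_2, directed_triangle} :: 'a pair_pre_digraph set) = 2 \<and>
         bdd_above (dichromatic_number `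
           (Forb_ind {digon, in_star_2, directed_triangle} :: 'a pair_pre_digraph set)) \<and>
         max_dichromatic_number
           (Forb_ind {digon, in_star_2, directed_triangle} :: 'a pair_pre_digraph set) = 2"
proof -
  let ?out_free = "Forb_ind {digon, out_star_2, directed_triangle} :: 'a pair_pre_digraph set"
  let ?in_free = "Forb_ind {digon, in_star_2, directed_triangle} :: 'a pair_pre_digraph set"
  obtain D :: "'a pair_pre_digraph" where C4: "pair_digraph D" "triangle_free_oriented (parcs D)"
      "out_tournaments (parcs D)" "out_tournaments ((parcs D)\<inverse>)"
      "\<not> acyclic (Restr (parcs D) (pverts D))"
    using directed_4_cycle_exists by blast
  have "bdd_above (dichromatic_number ` ?out_free) \<and> max_dichromatic_number ?out_free = 2"
  proof (rule max_dichromatic_number_eq_2[OF _ _ C4(1,5)])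
    show "D \<in> ?out_free" using C4 by (simp add: Forb_ind_out_star_iff)
    show "acyclic_colorable H 2" if "H \<in> ?out_free" for H
    proof -
      have H: "pair_digraph H" "triangle_free_oriented (parcs H)" "out_tournaments (parcs H)"
        using that by (simp_all add: Forb_ind_out_star_iff)
      then obtain c where "acyclic_bicoloring (parcs H) (pverts H) c"
        using out_tournaments_bicoloring[OF finite_pverts] by blast
      then show ?thesis by (rule acyclic_colorable_2[OF H(1)])
    qed
  qed
  moreover
  have "bdd_above (dichromatic_number ` ?in_free) \<and> max_dichromatic_number ?in_free = 2"
  proof (rule max_dichromatic_number_eq_2[OF _ _ C4(1,5)])
    show "D \<in> ?in_free" using C4 by (simp add: Forb_ind_in_star_iff)
    show "acyclic_colorable H 2" if "H \<in> ?in_free" for H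
    proof -
      have H: "pair_digraph H" "triangle_free_oriented (parcs H)" "out_tournaments ((parcs H)\<inverse>)"
        using that by (simp_all add: Forb_ind_in_star_iff)
      then obtain c where "acyclic_bicoloring ((parcs H)\<inverse>) (pverts H) c"
        using out_tournaments_bicoloring[OF finite_pverts triangle_free_oriented_converse] by blast
      then show ?thesis
        unfolding acyclic_bicoloring_converse by (rule acyclic_colorable_2[OF H(1)])
    qed
  qed
  ultimately show ?thesis by (simp only: simp_thms)
qed

end
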